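(* Let $H$ be a Hilbert space and $T\in B(H)$. If $T$ is normal, then $T$ is pointwise regular.
   Context: Hilbert spaces are complex. $R_T(\lambda)=(\lambda I-T)^{-1}$ for $\lambda\in\rho(T)=\mathbb{C}\setminus\sigma(T)$, and for $x\in X$, $R_T^x(\lambda)=R_T(\lambda)(x)$. A function $g$ from a measure space $(S,\Sigma,\mu)$ into a Banach space $X$ is Dunford integrable if $\Lambda\circ g\in L^1(\mu)$ for each $\Lambda\in X^{\ast}$. An operator $T\in B(X)$ on a Banach space $X$ is pointwise regular if for each $x\in X$ and every precompact neighborhood $\Omega$ of $\sigma(T)$ the function $R_T^x$ is Dunford integrable on $\Omega\setminus\sigma(T)$ with respect to Lebesgue measure. *)

theory Defs
  imports "HOL-Analysis.Analysis"
begin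

class complex_vector = real_vector +
  fixes scaleC :: "complex \<Rightarrow> 'a \<Rightarrow> 'a" (infixr "*\<^sub>C" 75)
  assumes scaleC_add_right: "a *\<^sub>C (x + y) = a *\<^sub>C x + a *\<^sub>C y"
    and scaleC_add_left: "(a + b) *\<^sub>C x = a *\<^sub>C x + b *\<^sub>C x"
    and scaleC_scaleC: "a *\<^sub>C b *\<^sub>C x = (a * b) *\<^sub>C x"
    and scaleC_of_real: "complex_of_real r *\<^sub>C x = r *\<^sub>R x"

class complex_normed_vector = complex_vector + real_normed_vector +
  assumes norm_scaleC: "norm (a *\<^sub>C x) = cmod a * norm x"

class cbanach = complex_normed_vector + banach

text \<open>The inner product is linear in the first and conjugate-linear in the second argument.\<close>

class complex_inner = complex_normed_vector +
  fixes cinner :: "'a \<Rightarrow> 'a \<Rightarrow> complex"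
  assumes cinner_commute: "cinner x y = cnj (cinner y x)"
    and cinner_add_left: "cinner (x + y) z = cinner x z + cinner y z"
    and cinner_scaleC_left: "cinner (a *\<^sub>C x) y = a * cinner x y"
    and cinner_norm: "cinner x x = complex_of_real ((norm x)\<^sup>2)"

class chilbert_space = complex_inner + cbanach

instantiation complex :: chilbert_space
begin

definition scaleC_complex :: "complex \<Rightarrow> complex \<Rightarrow> complex"
  where "scaleC_complex a x = a * x"

definition cinner_complex :: "complex \<Rightarrow> complex \<Rightarrow> complex"
  where "cinner_complex x y = x * cnj y"

instance
  by standard
    (simp_all add: scaleC_complex_def cinner_complex_def algebra_simps norm_mult
      scaleR_conv_of_real complex_norm_square del: of_real_power)

end

definition bounded_clinear ::
  "('a::complex_normed_vector \<Rightarrow> 'b::complex_normed_vector) \<Rightarrow> bool"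
  where "bounded_clinear f \<longleftrightarrow> bounded_linear f \<and> (\<forall>a x. f (a *\<^sub>C x) = a *\<^sub>C f x)"

definition cspectrum :: "('a::cbanach \<Rightarrow> 'a) \<Rightarrow> complex set"
  where "cspectrum T = {z. \<not> (\<exists>S. bounded_clinear S \<and>
    S \<circ> (\<lambda>x. z *\<^sub>C x - T x) = id \<and> (\<lambda>x. z *\<^sub>C x - T x) \<circ> S = id)}"

text \<open>Only meaningful for \<open>z \<notin> cspectrum T\<close>.\<close>

definition resolvent :: "('a::cbanach \<Rightarrow> 'a) \<Rightarrow> complex \<Rightarrow> 'a \<Rightarrow> 'a"
  where "resolvent T z = inv (\<lambda>x. z *\<^sub>C x - T x)"

definition dunford_integrable :: "'s measure \<Rightarrow> ('s \<Rightarrow> 'a::cbanach) \<Rightarrow> bool"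
  where "dunford_integrable M g \<longleftrightarrow>
    (\<forall>\<Lambda> :: 'a \<Rightarrow> complex. bounded_clinear \<Lambda> \<longrightarrow> integrable M (\<Lambda> \<circ> g))"

text \<open>Neighborhoods need not be open, but they have to be Lebesgue measurable for
  integration over \<open>\<Omega> - cspectrum T\<close> to make sense.\<close>

definition pointwise_regular :: "('a::cbanach \<Rightarrow> 'a) \<Rightarrow> bool"
  where "pointwise_regular T \<longleftrightarrow> bounded_clinear T \<and>
    (\<forall>x \<Omega>. \<Omega> \<in> sets lebesgue \<and> compact (closure \<Omega>) \<and> cspectrum T \<subseteq> interior \<Omega> \<longrightarrow>
      dunford_integrable (lebesgue_on (\<Omega> - cspectrum T)) (\<lambda>z. resolvent T z x))"

text \<open>For bounded \<open>T\<close> on a Hilbert space the adjoint exists and is unique, by the Riesz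
  representation theorem.\<close>

definition cadjoint :: "('a::chilbert_space \<Rightarrow> 'a) \<Rightarrow> 'a \<Rightarrow> 'a"
  where "cadjoint T = (THE S. \<forall>x y. cinner (T x) y = cinner x (S y))"

definition normal_operator :: "('a::chilbert_space \<Rightarrow> 'a) \<Rightarrow> bool"
  where "normal_operator T \<longleftrightarrow> T \<circ> cadjoint T = cadjoint T \<circ> T"

end

theory Submission
  imports Defs "HOL-Complex_Analysis.Complex_Analysis"
    "HOL-Computational_Algebra.Fundamental_Theorem_Algebra"
begin

text \<open>
  The spectral theorem is avoided. For a finite linear combination \<open>N\<close> of resolvents \<open>R(p)\<close> of \<open>T\<close>, with
  symbol \<open>r(w) = \<Sum> c(p) / (p - w)\<close>, partial fractions and factorization of polynomials show that
  \<open>I - z N\<close> is invertible whenever \<open>z r \<noteq> 1\<close> on the spectrum; since \<open>N\<close> is normal, its norm equals its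
  spectral radius and is therefore at most the supremum of \<open>\<bar>r\<bar>\<close> over the spectrum. Now
  \<open>\<integral> \<bar>\<Lambda> (R(z) x)\<bar>\<close> is a limit of sums \<open>\<Sum> m(p) \<bar>\<Lambda> (R(p) x)\<bar> = \<Lambda> (N x)\<close>, where \<open>c(p)\<close> is \<open>m(p)\<close> times a
  phase, and \<open>\<bar>r(w)\<bar>\<close> is then controlled by \<open>\<integral> 1 / \<bar>z - w\<bar>\<close>, which is bounded uniformly in \<open>w\<close>.
\<close>

section \<open>Complex Hilbert spaces\<close>

text \<open>The class \<open>complex_vector\<close> postulates no unit law; it follows from
  compatibility with real scaling at the scalar 1.\<close>

interpretation scaleC: vector_space "scaleC :: complex \<Rightarrow> 'a::complex_vector \<Rightarrow> 'a"
proof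
  show "1 *\<^sub>C x = x" for x :: 'a
    using scaleC_of_real[of 1 x] by simp
qed (simp_all add: scaleC_add_right scaleC_add_left scaleC_scaleC)

lemma bounded_clinearI:
  assumes "\<And>x y. f (x + y) = f x + f y" "\<And>a x. f (a *\<^sub>C x) = a *\<^sub>C f x"
    "\<And>x. norm (f x) \<le> K * norm x"
  shows "bounded_clinear f"
  unfolding bounded_clinear_def
proof
  show "bounded_linear f"
    using assms by (intro bounded_linear_intro[of _ K]) (auto simp: mult.commute simp flip: scaleC_of_real)
qed (use assms in auto)

lemma bounded_clinear_bounded_linear: "bounded_clinear f \<Longrightarrow> bounded_linear f"
  by (simp add: bounded_clinear_def)

lemma bounded_clinear_scaleC: "bounded_clinear f \<Longrightarrow> f (a *\<^sub>C x) = a *\<^sub>C f x"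
  by (simp add: bounded_clinear_def)

lemma bounded_clinear_simps:
  assumes "bounded_clinear f"
  shows "f (x + y) = f x + f y" "f (x - y) = f x - f y" "f (- x) = - f x" "f 0 = 0"
    "f (sum g A) = (\<Sum>i\<in>A. f (g i))" "f (a *\<^sub>C x) = a *\<^sub>C f x"
proof -
  interpret bounded_linear f
    using assms by (rule bounded_clinear_bounded_linear)
  show "f (x + y) = f x + f y" "f (x - y) = f x - f y" "f (- x) = - f x" "f 0 = 0"
    "f (sum g A) = (\<Sum>i\<in>A. f (g i))"
    by (simp_all add: add diff neg zero sum)
qed (use assms in \<open>simp add: bounded_clinear_scaleC\<close>)

lemma bounded_clinear_bound:
  assumes "bounded_clinear f"
  obtains K where "K > 0" "\<And>x. norm (f x) \<le> K * norm x"
  using bounded_linear.pos_bounded[OF bounded_clinear_bounded_linear[OF assms]]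
  by (metis mult.commute)

lemma bounded_clinear_compose:
  "bounded_clinear f \<Longrightarrow> bounded_clinear g \<Longrightarrow> bounded_clinear (\<lambda>x. f (g x))"
  unfolding bounded_clinear_def using bounded_linear_compose by auto

lemma bounded_clinear_id: "bounded_clinear (\<lambda>x. x)"
  by (rule bounded_clinearI[of _ 1]) auto

lemma bounded_clinear_zero: "bounded_clinear (\<lambda>x. 0)"
  by (rule bounded_clinearI[of _ 0]) auto

lemma bounded_clinear_add:
  "bounded_clinear f \<Longrightarrow> bounded_clinear g \<Longrightarrow> bounded_clinear (\<lambda>x. f x + g x)"
  unfolding bounded_clinear_def by (auto simp: bounded_linear_add scaleC_add_right)

lemma bounded_clinear_scale:
  assumes "bounded_clinear f"
  shows "bounded_clinear (\<lambda>x. a *\<^sub>C f x)"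
proof -
  obtain K where K: "\<And>x. norm (f x) \<le> K * norm x"
    using bounded_clinear_bound[OF assms] by metis
  show ?thesis
  proof (rule bounded_clinearI)
    show "norm (a *\<^sub>C f x) \<le> (cmod a * K) * norm x" for x
      using mult_left_mono[OF K[of x], of "cmod a"] by (simp add: norm_scaleC mult.assoc)
  qed (simp_all add: bounded_clinear_simps[OF assms] scaleC_add_right mult.commute)
qed

lemma bounded_clinear_sum:
  assumes "\<And>i. i \<in> A \<Longrightarrow> bounded_clinear (f i)"
  shows "bounded_clinear (\<lambda>x. \<Sum>i\<in>A. f i x)"
  using assms
  by (induction A rule: infinite_finite_induct) (auto simp: bounded_clinear_zero bounded_clinear_add)

section \<open>Inner products, the Cauchy-Schwarz inequality and the parallelogram law\<close>

lemma cinner_add_right: "cinner x (y + z) = cinner x y + cinner x z"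
  by (metis cinner_commute cinner_add_left complex_cnj_add)

lemma cinner_scaleC_right: "cinner x (a *\<^sub>C y) = cnj a * cinner x y"
  by (metis cinner_commute cinner_scaleC_left complex_cnj_mult)

lemma cinner_zero_left [simp]: "cinner 0 y = 0"
  using cinner_scaleC_left[of 0 0 y] by simp

lemma cinner_zero_right [simp]: "cinner x 0 = 0"
  using cinner_scaleC_right[of x 0 0] by simp

lemma cinner_minus_left: "cinner (- x) y = - cinner x y"
  using cinner_scaleC_left[of "-1" x y] by simp

lemma cinner_minus_right: "cinner x (- y) = - cinner x y"
  using cinner_scaleC_right[of x "-1" y] by simp

lemma cinner_diff_left: "cinner (x - y) z = cinner x z - cinner y z"
  using cinner_add_left[of x "- y" z] by (simp add: cinner_minus_left)

lemma cinner_diff_right: "cinner x (y - z) = cinner x y - cinner x z"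
  using cinner_add_right[of x y "- z"] by (simp add: cinner_minus_right)

lemmas cinner_simps = cinner_add_left cinner_add_right cinner_diff_left cinner_diff_right
  cinner_scaleC_left cinner_scaleC_right cinner_minus_left cinner_minus_right

lemma norm_diff_scaleC_square:
  fixes x y :: "'a::complex_inner"
  shows "(norm (x - a *\<^sub>C y))\<^sup>2 = (norm x)\<^sup>2 - 2 * Re (cnj a * cinner x y) + (cmod a)\<^sup>2 * (norm y)\<^sup>2"
proof -
  have "complex_of_real ((norm (x - a *\<^sub>C y))\<^sup>2) = cinner (x - a *\<^sub>C y) (x - a *\<^sub>C y)"
    by (rule cinner_norm [symmetric])
  also have "\<dots> = cinner x x - (cnj a * cinner x y + a * cinner y x) + (a * cnj a) * cinner y y"
    by (simp add: cinner_simps algebra_simps)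
  also have "a * cinner y x = cnj (cnj a * cinner x y)"
    using cinner_commute[of y x] by simp
  also have "a * cnj a = complex_of_real ((cmod a)\<^sup>2)"
    by (rule complex_norm_square[symmetric])
  finally show ?thesis
    unfolding cinner_norm complex_add_cnj
    by (metis (no_types, lifting) of_real_add of_real_diff of_real_eq_iff of_real_mult)
qed

text \<open>The scalar minimizing \<open>norm (x - a *\<^sub>C y)\<close> is \<open>cinner x y / (norm y)\<^sup>2\<close>.\<close>

lemma norm_diff_projection:
  fixes x y :: "'a::complex_inner"
  assumes "y \<noteq> 0"
  shows "(norm (x - (cinner x y / (norm y)\<^sup>2) *\<^sub>C y))\<^sup>2 = (norm x)\<^sup>2 - (cmod (cinner x y))\<^sup>2 / (norm y)\<^sup>2"
proof -
  have *: "cnj (cinner x y) * cinner x y = complex_of_real ((cmod (cinner x y))\<^sup>2)"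
    using complex_norm_square[of "cinner x y"] by (simp add: mult.commute)
  have "cnj (cinner x y / (norm y)\<^sup>2) * cinner x y = complex_of_real ((cmod (cinner x y))\<^sup>2 / (norm y)\<^sup>2)"
    using * by simp
  then have "Re (cnj (cinner x y / (norm y)\<^sup>2) * cinner x y) = (cmod (cinner x y))\<^sup>2 / (norm y)\<^sup>2"
    by (metis Re_complex_of_real)
  moreover have "(cmod (cinner x y / (norm y)\<^sup>2))\<^sup>2 * (norm y)\<^sup>2 = (cmod (cinner x y))\<^sup>2 / (norm y)\<^sup>2"
    using assms by (simp add: norm_divide norm_power power_divide field_simps flip: power_mult power_add)
  ultimately show ?thesis
    using norm_diff_scaleC_square[of x "cinner x y / (norm y)\<^sup>2" y] by linarith
qed

text \<open>The squared distance from \<open>x\<close> to its projection on the line through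
  \<open>y\<close> is nonnegative.\<close>

lemma cauchy_schwarz:
  fixes x y :: "'a::complex_inner"
  shows "cmod (cinner x y) \<le> norm x * norm y"
proof (cases "y = 0")
  case False
  have "0 \<le> (norm x)\<^sup>2 - (cmod (cinner x y))\<^sup>2 / (norm y)\<^sup>2"
    using norm_diff_projection[OF False, of x] by (metis zero_le_power2)
  then have "(cmod (cinner x y))\<^sup>2 \<le> (norm x * norm y)\<^sup>2"
    using False by (simp add: field_simps power_mult_distrib)
  then show ?thesis
    by (rule power2_le_imp_le) simp
qed simp

lemma parallelogram:
  fixes x y :: "'a::complex_inner"
  shows "(norm (x + y))\<^sup>2 + (norm (x - y))\<^sup>2 = 2 * (norm x)\<^sup>2 + 2 * (norm y)\<^sup>2"
  using norm_diff_scaleC_square[of x 1 y] norm_diff_scaleC_square[of x "-1" y] by simp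

section \<open>Points of least norm, Riesz representation and adjoints\<close>

lemma min_norm_exists:
  fixes S :: "'a::chilbert_space set"
  assumes "closed S" "convex S" "S \<noteq> {}"
  obtains u where "u \<in> S" "\<And>x. x \<in> S \<Longrightarrow> norm u \<le> norm x"
proof -
  define d where "d = Inf (norm ` S)"
  have bdd: "bdd_below (norm ` S)"
    by (auto intro!: bdd_belowI[of _ 0])
  have d: "d \<le> norm x" if "x \<in> S" for x
    unfolding d_def using that bdd by (auto intro: cInf_lower)
  have d0: "0 \<le> d"
    unfolding d_def using assms(3) by (intro cInf_greatest) auto
  have "\<exists>x\<in>S. norm x < d + 1 / Suc n" for n
  proof -
    have "Inf (norm ` S) < d + 1 / Suc n"
      by (simp add: d_def)
    then show ?thesis
      using assms(3) bdd by (subst (asm) cInf_less_iff) auto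
  qed
  then obtain X where X: "\<And>n. X n \<in> S" "\<And>n. norm (X n) < d + 1 / Suc n"
    by metis
  have lim: "(\<lambda>n. norm (X n)) \<longlonglongrightarrow> d"
  proof (rule tendsto_sandwich[of "\<lambda>n. d" _ _ "\<lambda>n. d + 1 / Suc n"])
    show "(\<lambda>n. d + 1 / Suc n) \<longlonglongrightarrow> d"
      using tendsto_add[OF tendsto_const[of d] LIMSEQ_Suc[OF lim_1_over_n]] by simp
  qed (use X d in \<open>auto intro: always_eventually less_imp_le\<close>)
  \<comment> \<open>Midpoints stay in the convex set, so their norm is at least \<open>d\<close>,
    and the parallelogram law makes almost minimal points close to each other. An excess of
    \<open>e\<^sup>2 / 4\<close> over \<open>d\<^sup>2\<close> at both points gives distance below
    \<open>e\<close>.\<close>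
  have mid: "(norm (x - y))\<^sup>2 \<le> 2 * (norm x)\<^sup>2 + 2 * (norm y)\<^sup>2 - 4 * d\<^sup>2" if "x \<in> S" "y \<in> S" for x y
  proof -
    have "(1/2) *\<^sub>R x + (1/2) *\<^sub>R y \<in> S"
      using convexD[OF assms(2) that, of "1/2" "1/2"] by simp
    then have "d \<le> norm ((1/2) *\<^sub>R (x + y))"
      using d by (simp add: scaleR_add_right)
    then have "(2 * d)\<^sup>2 \<le> (norm (x + y))\<^sup>2"
      using d0 by (intro power_mono) auto
    then show ?thesis
      using parallelogram[of x y] by simp
  qed
  have "Cauchy X"
  proof (rule CauchyI)
    fix e :: real
    assume e: "0 < e"
    have "(\<lambda>n. (norm (X n))\<^sup>2) \<longlonglongrightarrow> d\<^sup>2"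
      by (intro tendsto_power lim)
    then have "\<forall>\<^sub>F n in sequentially. (norm (X n))\<^sup>2 < d\<^sup>2 + e\<^sup>2 / 4"
      using e by (intro order_tendstoD) auto
    then obtain M where M: "\<And>n. n \<ge> M \<Longrightarrow> (norm (X n))\<^sup>2 < d\<^sup>2 + e\<^sup>2 / 4"
      by (auto simp: eventually_sequentially)
    have "norm (X m - X n) < e" if "m \<ge> M" "n \<ge> M" for m n
    proof -
      have "(norm (X m - X n))\<^sup>2 < e\<^sup>2"
        using mid[OF X(1) X(1), of m n] M[OF that(1)] M[OF that(2)] by simp
      then show ?thesis
        using e by (simp add: power2_less_imp_less)
    qed
    then show "\<exists>M. \<forall>m\<ge>M. \<forall>n\<ge>M. norm (X m - X n) < e"
      by blast
  qed
  then obtain u where u: "X \<longlonglongrightarrow> u"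
    by (auto simp: Cauchy_convergent_iff convergent_def)
  show thesis
  proof
    show "u \<in> S"
      using closed_sequentially[OF assms(1) _ u] X by blast
    have "norm u = d"
      using tendsto_norm[OF u] lim by (rule LIMSEQ_unique)
    then show "norm u \<le> norm x" if "x \<in> S" for x
      using d that by simp
  qed
qed

text \<open>The point \<open>u\<close> of least norm on the affine hyperplane where
  \<open>\<Lambda>\<close> equals 1 is orthogonal to the kernel of \<open>\<Lambda>\<close>. Since
  \<open>x - \<Lambda> x *\<^sub>C u\<close> lies in that kernel, a rescaled \<open>u\<close>
  represents \<open>\<Lambda>\<close>.\<close>

theorem riesz_representation:
  fixes \<Lambda> :: "'a::chilbert_space \<Rightarrow> complex"
  assumes "bounded_clinear \<Lambda>"
  obtains v where "\<And>x. \<Lambda> x = cinner x v"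
proof (cases "\<forall>x. \<Lambda> x = 0")
  case True
  then show ?thesis
    using that[of 0] by simp
next
  case False
  note \<Lambda> = bounded_clinear_simps[OF assms, unfolded scaleC_complex_def]
  interpret bl: bounded_linear \<Lambda>
    using assms by (rule bounded_clinear_bounded_linear)
  from False obtain a where a: "\<Lambda> a \<noteq> 0"
    by blast
  define S where "S = {x. \<Lambda> x = 1}"
  have "(1 / \<Lambda> a) *\<^sub>C a \<in> S"
    using a by (simp add: S_def \<Lambda>)
  then have "S \<noteq> {}"
    by blast
  moreover have "closed S"
    unfolding S_def by (intro closed_Collect_eq bl.continuous_on continuous_intros)
  moreover have "convex S"
    unfolding S_def convex_def by (auto simp: bl.add bl.scale scaleR_conv_of_real simp flip: of_real_add)
  ultimately obtain u where u: "u \<in> S" "\<And>x. x \<in> S \<Longrightarrow> norm u \<le> norm x"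
    using min_norm_exists by blast
  have \<Lambda>u: "\<Lambda> u = 1"
    using u by (simp add: S_def)
  then have u0: "u \<noteq> 0"
    using \<Lambda>(4) by force
  have orth: "cinner z u = 0" if z: "\<Lambda> z = 0" for z
  proof (cases "z = 0")
    case False
    \<comment> \<open>Subtracting the projection of \<open>u\<close> on \<open>z\<close> stays in
      \<open>S\<close> but would shorten \<open>u\<close> unless the two were orthogonal.\<close>
    define b where "b = cinner u z / (norm z)\<^sup>2"
    have "u - b *\<^sub>C z \<in> S"
      using \<Lambda>u z by (simp add: S_def \<Lambda>)
    then have "(norm u)\<^sup>2 \<le> (norm (u - b *\<^sub>C z))\<^sup>2"
      using u(2) by (intro power_mono) auto
    also have "\<dots> = (norm u)\<^sup>2 - (cmod (cinner u z))\<^sup>2 / (norm z)\<^sup>2"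
      unfolding b_def by (rule norm_diff_projection[OF False])
    finally have "(cmod (cinner u z))\<^sup>2 / (norm z)\<^sup>2 \<le> 0"
      by simp
    then have "cinner u z = 0"
      using False by (simp add: divide_le_0_iff)
    then show ?thesis
      using cinner_commute[of z u] by simp
  qed simp
  show thesis
  proof (rule that)
    fix x
    have "\<Lambda> (x - \<Lambda> x *\<^sub>C u) = 0"
      by (simp add: \<Lambda> \<Lambda>u)
    then have "cinner x u - \<Lambda> x * cinner u u = 0"
      using orth by (metis cinner_diff_left cinner_scaleC_left)
    then have "cinner x u = \<Lambda> x * (norm u)\<^sup>2"
      by (simp add: cinner_norm)
    then show "\<Lambda> x = cinner x ((1 / (norm u)\<^sup>2) *\<^sub>C u)"
      using u0 by (simp add: cinner_scaleC_right)
  qed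
qed

lemma cinner_ext:
  assumes "\<And>x. cinner x y = cinner x z"
  shows "y = z"
proof -
  have "cinner (y - z) (y - z) = 0"
    using assms by (simp add: cinner_diff_right)
  then show ?thesis
    by (simp add: cinner_norm)
qed

text \<open>Riesz representation of the functional sending \<open>x\<close> to
  \<open>cinner (A x) y\<close> yields \<open>S y\<close>. Boundedness comes from estimating
  \<open>cinner (S y) (S y) = cinner (A (S y)) y\<close> and cancelling one factor
  \<open>norm (S y)\<close>.\<close>

lemma adjoint_exists:
  fixes A :: "'a::chilbert_space \<Rightarrow> 'a"
  assumes "bounded_clinear A"
  obtains S where "\<And>x y. cinner (A x) y = cinner x (S y)" "bounded_clinear S"
proof -
  obtain K where K: "K > 0" "\<And>x. norm (A x) \<le> K * norm x"
    using bounded_clinear_bound[OF assms] by metis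
  have "\<exists>v. \<forall>x. cinner (A x) y = cinner x v" for y
  proof -
    have "bounded_clinear (\<lambda>x. cinner (A x) y)"
    proof (rule bounded_clinearI)
      fix x
      show "norm (cinner (A x) y) \<le> (K * norm y) * norm x"
        using cauchy_schwarz[of "A x" y] mult_right_mono[OF K(2)[of x], of "norm y"] by (simp add: mult_ac)
    qed (simp_all add: bounded_clinear_simps[OF assms] cinner_simps scaleC_complex_def)
    from riesz_representation[OF this] show ?thesis
      by metis
  qed
  then obtain S where S: "\<And>x y. cinner (A x) y = cinner x (S y)"
    by metis
  have "bounded_clinear S"
  proof (rule bounded_clinearI)
    fix x y a
    show "S (x + y) = S x + S y"
      by (rule cinner_ext) (simp add: cinner_add_right flip: S)
    show "S (a *\<^sub>C x) = a *\<^sub>C S x"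
      by (rule cinner_ext) (simp add: cinner_scaleC_right flip: S)
    have "(norm (S x))\<^sup>2 = cmod (cinner (S x) (S x))"
      by (simp add: cinner_norm norm_power)
    also have "\<dots> = cmod (cinner (A (S x)) x)"
      by (simp add: S)
    also have "\<dots> \<le> norm (A (S x)) * norm x"
      by (rule cauchy_schwarz)
    also have "\<dots> \<le> K * norm (S x) * norm x"
      by (intro mult_right_mono K) simp
    finally have "norm (S x) * norm (S x) \<le> norm (S x) * (K * norm x)"
      by (simp add: power2_eq_square mult_ac)
    then show "norm (S x) \<le> K * norm x"
      using K(1) by (cases "S x = 0") auto
  qed
  with S show thesis
    using that by blast
qed

text \<open>The definite description in \<open>cadjoint\<close> is justified here: the adjoint
  exists, and \<open>cinner_ext\<close> makes it unique.\<close>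

lemma cadjoint:
  fixes A :: "'a::chilbert_space \<Rightarrow> 'a"
  assumes "bounded_clinear A"
  shows "cinner (A x) y = cinner x (cadjoint A y)" "bounded_clinear (cadjoint A)"
proof -
  obtain S where S: "\<And>x y. cinner (A x) y = cinner x (S y)" "bounded_clinear S"
    using adjoint_exists[OF assms] by blast
  have "cadjoint A = S"
    unfolding cadjoint_def
  proof (rule the_equality)
    fix S' assume "\<forall>x y. cinner (A x) y = cinner x (S' y)"
    then show "S' = S"
      using S(1) by - (rule ext, rule cinner_ext, simp)
  qed (simp add: S)
  with S show "cinner (A x) y = cinner x (cadjoint A y)" "bounded_clinear (cadjoint A)"
    by simp_all
qed

section \<open>Inverses of operators\<close>

text \<open>A relation between an operator and its inverse serves all families in play alike:
  \<open>z - T\<close>, polynomials in \<open>T\<close>, and \<open>I - z N\<close>.\<close>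

definition inverse_operator ::
  "('a::complex_normed_vector \<Rightarrow> 'a) \<Rightarrow> ('a \<Rightarrow> 'a) \<Rightarrow> bool"
  where "inverse_operator A S \<longleftrightarrow> bounded_clinear S \<and> (\<forall>x. S (A x) = x) \<and> (\<forall>x. A (S x) = x)"

lemma inverse_operatorD:
  assumes "inverse_operator A S"
  shows "bounded_clinear S" "S (A x) = x" "A (S x) = x"
  using assms by (auto simp: inverse_operator_def)

lemma inverse_operator_compose:
  assumes "inverse_operator A S" "inverse_operator B S'"
  shows "inverse_operator (\<lambda>x. A (B x)) (\<lambda>x. S' (S x))"
  using assms by (auto simp: inverse_operator_def intro: bounded_clinear_compose)

text \<open>Bijectivity gives a linear inverse, and the lower bound on \<open>A\<close> is exactly
  the upper bound on that inverse.\<close>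

lemma inverse_operatorI:
  fixes A :: "'a::complex_normed_vector \<Rightarrow> 'a"
  assumes A: "bounded_clinear A" and bij: "\<And>y. \<exists>!x. A x = y"
    and bound: "\<And>x. norm x \<le> K * norm (A x)"
  shows "\<exists>S. inverse_operator A S"
proof -
  obtain S where S: "\<And>y. A (S y) = y"
    using bij by metis
  have S': "S (A x) = x" for x
    using bij[of "A x"] S by blast
  have "bounded_clinear S"
  proof (rule bounded_clinearI)
    show "S (x + y) = S x + S y" for x y
      by (metis S S' bounded_clinear_simps(1)[OF A])
    show "S (a *\<^sub>C x) = a *\<^sub>C S x" for a x
      by (metis S S' bounded_clinear_scaleC[OF A])
    show "norm (S x) \<le> K * norm x" for x
      using bound[of "S x"] by (simp add: S)
  qed
  with S S' show ?thesis
    by (auto simp: inverse_operator_def)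
qed

lemma not_in_cspectrum_iff:
  "z \<notin> cspectrum T \<longleftrightarrow> (\<exists>S. inverse_operator (\<lambda>x. z *\<^sub>C x - T x) S)"
  by (auto simp: cspectrum_def inverse_operator_def fun_eq_iff)

text \<open>\<open>resolvent\<close> is given by the choice function \<open>inv\<close>; a two-sided
  inverse leaves only one choice.\<close>

lemma inverse_operator_resolvent:
  assumes "z \<notin> cspectrum T"
  shows "inverse_operator (\<lambda>x. z *\<^sub>C x - T x) (resolvent T z)"
proof -
  obtain S where S: "inverse_operator (\<lambda>x. z *\<^sub>C x - T x) S"
    using assms by (auto simp: not_in_cspectrum_iff)
  then have "resolvent T z = S"
    unfolding resolvent_def inverse_operator_def
    by (intro inv_unique_comp) (auto simp: fun_eq_iff)
  with S show ?thesis
    by simp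
qed

text \<open>Resolvents and the inverses of \<open>I - z N\<close> are both inverses of a pencil \<open>A + z B\<close>.\<close>

lemma pencil_inverse_identity:
  assumes "inverse_operator (\<lambda>x. A x + z *\<^sub>C B x) S" "inverse_operator (\<lambda>x. A x + w *\<^sub>C B x) S'"
  shows "S' x - S x = (z - w) *\<^sub>C S (B (S' x))"
proof -
  have "A (S' x) + z *\<^sub>C B (S' x) = x + (z - w) *\<^sub>C B (S' x)"
    using inverse_operatorD(3)[OF assms(2), of x] by (simp add: scaleC.scale_left_diff_distrib algebra_simps)
  then have "S' x = S (x + (z - w) *\<^sub>C B (S' x))"
    using inverse_operatorD(2)[OF assms(1), of "S' x"] by simp
  also have "\<dots> = S x + (z - w) *\<^sub>C S (B (S' x))"
    by (simp add: bounded_clinear_simps[OF inverse_operatorD(1)[OF assms(1)]])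
  finally show ?thesis
    by (simp add: algebra_simps)
qed

text \<open>Applying \<open>S\<close> turns the equation \<open>A x + w *\<^sub>C B x = y\<close>
  into the fixed point equation \<open>x = S y - (w - z) *\<^sub>C S (B x)\<close>. For
  \<open>w\<close> within \<open>1 / (2 * K)\<close> of \<open>z\<close> its right side is a
  contraction with factor 1/2, so Banach's theorem gives a unique solution.\<close>

lemma pencil_inverse_exists_nearby:
  fixes A B :: "'a::cbanach \<Rightarrow> 'a"
  assumes A: "bounded_clinear A" and B: "bounded_clinear B"
    and S: "inverse_operator (\<lambda>x. A x + z *\<^sub>C B x) S"
  shows "\<exists>e>0. \<forall>w. cmod (w - z) < e \<longrightarrow> (\<exists>S'. inverse_operator (\<lambda>x. A x + w *\<^sub>C B x) S')"
proof -
  note bS = inverse_operatorD(1)[OF S]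
  obtain K where K: "K > 0" "\<And>x. norm (S (B x)) \<le> K * norm x"
    using bounded_clinear_bound[OF bounded_clinear_compose[OF bS B]] by metis
  obtain L where L: "L > 0" "\<And>x. norm (S x) \<le> L * norm x"
    using bounded_clinear_bound[OF bS] by metis
  have "\<exists>S'. inverse_operator (\<lambda>x. A x + w *\<^sub>C B x) S'" if w: "cmod (w - z) < 1 / (2 * K)" for w
  proof -
    have small: "norm ((w - z) *\<^sub>C S (B x)) \<le> 1/2 * norm x" for x
    proof -
      have "norm ((w - z) *\<^sub>C S (B x)) \<le> (1 / (2 * K)) * (K * norm x)"
        unfolding norm_scaleC using w K by (intro mult_mono) auto
      then show ?thesis
        using K(1) by simp
    qed
    have eq: "S (A x + w *\<^sub>C B x) = x + (w - z) *\<^sub>C S (B x)" for x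
    proof -
      have "A x + w *\<^sub>C B x = (A x + z *\<^sub>C B x) + (w - z) *\<^sub>C B x"
        by (simp add: scaleC.scale_left_diff_distrib)
      then show ?thesis
        using inverse_operatorD(2)[OF S, of x] by (simp add: bounded_clinear_simps[OF bS])
    qed
    show ?thesis
    proof (rule inverse_operatorI)
      show "bounded_clinear (\<lambda>x. A x + w *\<^sub>C B x)"
        by (intro bounded_clinear_add bounded_clinear_scale A B)
      fix y
      have "\<exists>!x. S y - (w - z) *\<^sub>C S (B x) = x"
      proof (rule banach_fix_type[of "1/2"])
        show "\<forall>u v. dist (S y - (w - z) *\<^sub>C S (B u)) (S y - (w - z) *\<^sub>C S (B v)) \<le> 1 / 2 * dist u v"
        proof (intro allI)
          fix u v
          have "(w - z) *\<^sub>C S (B u) - (w - z) *\<^sub>C S (B v) = (w - z) *\<^sub>C S (B (u - v))"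
            by (simp add: bounded_clinear_simps[OF bS] bounded_clinear_simps[OF B] scaleC.scale_right_diff_distrib)
          then show "dist (S y - (w - z) *\<^sub>C S (B u)) (S y - (w - z) *\<^sub>C S (B v)) \<le> 1 / 2 * dist u v"
            using small[of "u - v"] by (simp add: dist_norm norm_minus_commute)
        qed
      qed auto
      moreover have "A x + w *\<^sub>C B x = y \<longleftrightarrow> S y - (w - z) *\<^sub>C S (B x) = x" for x
        using eq[of x] inverse_operatorD(3)[OF S] by (metis add_diff_cancel_right' diff_add_cancel)
      ultimately show "\<exists>!x. A x + w *\<^sub>C B x = y"
        by simp
    next
      fix x
      have "norm x \<le> norm (S (A x + w *\<^sub>C B x)) + norm ((w - z) *\<^sub>C S (B x))"
        using norm_triangle_ineq4[of "S (A x + w *\<^sub>C B x)" "(w - z) *\<^sub>C S (B x)"] by (simp add: eq)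
      \<comment> \<open>Absorbing the half of \<open>norm x\<close> into the left side doubles the
        constant \<open>L\<close>.\<close>
      also have "\<dots> \<le> L * norm (A x + w *\<^sub>C B x) + 1/2 * norm x"
        by (intro add_mono L small)
      finally show "norm x \<le> (2 * L) * norm (A x + w *\<^sub>C B x)"
        by simp
    qed
  qed
  then show ?thesis
    using K(1) by (intro exI[of _ "1 / (2 * K)"]) auto
qed

text \<open>The pencil identity bounds \<open>S w x - S z x\<close> in terms of \<open>S w x\<close>
  itself. Near \<open>z\<close> this first shows \<open>norm (S w x) \<le> 2 * norm (S z x)\<close>;
  fed back, it gives a bound linear in the distance of \<open>w\<close> from
  \<open>z\<close>.\<close>

lemma tendsto_pencil_inverse:
  assumes B: "bounded_clinear B"
    and S: "\<And>z. z \<in> U \<Longrightarrow> inverse_operator (\<lambda>x. A x + z *\<^sub>C B x) (S z)" and z: "z \<in> U"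
  shows "((\<lambda>w. S w x) \<longlongrightarrow> S z x) (at z within U)"
proof -
  obtain K where K: "K > 0" "\<And>x. norm (S z (B x)) \<le> K * norm x"
    using bounded_clinear_bound[OF bounded_clinear_compose[OF inverse_operatorD(1)[OF S[OF z]] B]] by metis
  have le: "norm (S w x - S z x) \<le> cmod (z - w) * (K * norm (S w x))" if "w \<in> U" for w
    unfolding pencil_inverse_identity[OF S[OF z] S[OF that]] norm_scaleC
    by (intro mult_left_mono K) simp
  have le': "norm (S w x - S z x) \<le> cmod (z - w) * (K * (2 * norm (S z x)))"
    if w: "w \<in> U" "dist w z < 1 / (2 * K)" for w
  proof -
    have "cmod (z - w) * (K * norm (S w x)) \<le> (1 / (2 * K)) * (K * norm (S w x))"
      using w K(1) by (intro mult_right_mono) (auto simp: dist_norm norm_minus_commute)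
    also have "\<dots> = 1/2 * norm (S w x)"
      using K(1) by simp
    finally have "norm (S w x - S z x) \<le> 1/2 * norm (S w x)"
      using le[OF w(1)] by linarith
    moreover have "norm (S w x) \<le> norm (S w x - S z x) + norm (S z x)"
      using norm_triangle_ineq[of "S w x - S z x" "S z x"] by simp
    ultimately have "norm (S w x) \<le> 2 * norm (S z x)"
      by linarith
    then have "cmod (z - w) * (K * norm (S w x)) \<le> cmod (z - w) * (K * (2 * norm (S z x)))"
      using K(1) by (intro mult_left_mono) auto
    then show ?thesis
      using le[OF w(1)] by linarith
  qed
  have "((\<lambda>w. S w x - S z x) \<longlongrightarrow> 0) (at z within U)"
  proof (rule Lim_null_comparison)
    show "\<forall>\<^sub>F w in at z within U. norm (S w x - S z x) \<le> cmod (z - w) * (K * (2 * norm (S z x)))"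
      unfolding eventually_at using le' K(1) by (intro exI[of _ "1 / (2 * K)"]) auto
    have "((\<lambda>w. cmod (z - w) * (K * (2 * norm (S z x)))) \<longlongrightarrow> cmod (z - z) * (K * (2 * norm (S z x)))) (at z within U)"
      by (intro tendsto_intros)
    then show "((\<lambda>w. cmod (z - w) * (K * (2 * norm (S z x)))) \<longlongrightarrow> 0) (at z within U)"
      by simp
  qed
  then show ?thesis
    by (rule LIM_zero_cancel)
qed

lemma continuous_on_pencil_inverse:
  assumes "bounded_clinear B" "\<And>z. z \<in> U \<Longrightarrow> inverse_operator (\<lambda>x. A x + z *\<^sub>C B x) (S z)"
  shows "continuous_on U (\<lambda>z. S z x)"
  unfolding continuous_on_def using tendsto_pencil_inverse[OF assms] by blast

text \<open>By the pencil identity the difference quotient equals \<open>\<Phi> (S w x)\<close> for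
  a bounded linear \<open>\<Phi>\<close> depending on \<open>z\<close> only, so differentiability
  reduces to the continuity just proved.\<close>

lemma holomorphic_on_pencil_inverse:
  fixes \<Lambda> :: "'a::complex_normed_vector \<Rightarrow> complex"
  assumes \<Lambda>: "bounded_clinear \<Lambda>" and B: "bounded_clinear B"
    and S: "\<And>z. z \<in> U \<Longrightarrow> inverse_operator (\<lambda>x. A x + z *\<^sub>C B x) (S z)"
  shows "(\<lambda>z. \<Lambda> (S z x)) holomorphic_on U"
  unfolding holomorphic_on_def field_differentiable_def has_field_derivative_iff
proof (intro ballI exI)
  fix z assume z: "z \<in> U"
  define \<Phi> where "\<Phi> = (\<lambda>v. - \<Lambda> (S z (B v)))"
  have bl: "bounded_linear \<Phi>"
    unfolding \<Phi>_def
    by (rule bounded_linear_minus, rule bounded_clinear_bounded_linear, rule bounded_clinear_compose[OF \<Lambda>],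
        rule bounded_clinear_compose[OF inverse_operatorD(1)[OF S[OF z]] B])
  have "((\<lambda>w. \<Phi> (S w x)) \<longlongrightarrow> \<Phi> (S z x)) (at z within U)"
    by (rule bounded_linear.tendsto[OF bl tendsto_pencil_inverse[OF B S z]])
  moreover have "\<forall>\<^sub>F w in at z within U. \<Phi> (S w x) = (\<Lambda> (S w x) - \<Lambda> (S z x)) / (w - z)"
    unfolding eventually_at_filter
  proof (intro always_eventually allI impI)
    fix w assume w: "w \<noteq> z" "w \<in> U"
    have "\<Lambda> (S w x) - \<Lambda> (S z x) = \<Lambda> ((z - w) *\<^sub>C S z (B (S w x)))"
      unfolding pencil_inverse_identity[OF S[OF z] S[OF w(2)], symmetric]
      by (simp add: bounded_clinear_simps[OF \<Lambda>])
    also have "\<dots> = (w - z) * \<Phi> (S w x)"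
      by (simp add: bounded_clinear_simps[OF \<Lambda>] scaleC_complex_def \<Phi>_def algebra_simps)
    finally show "\<Phi> (S w x) = (\<Lambda> (S w x) - \<Lambda> (S z x)) / (w - z)"
      using w by simp
  qed
  ultimately show "((\<lambda>w. (\<Lambda> (S w x) - \<Lambda> (S z x)) / (w - z)) \<longlongrightarrow> \<Phi> (S z x)) (at z within U)"
    by (rule Lim_transform_eventually)
qed

lemma resolvent_pencil:
  fixes T :: "'a::cbanach \<Rightarrow> 'a"
  shows "(\<lambda>x. z *\<^sub>C x - T x) = (\<lambda>x. (- T x) + z *\<^sub>C x)"
  by auto

lemma closed_cspectrum:
  fixes T :: "'a::cbanach \<Rightarrow> 'a"
  assumes "bounded_clinear T"
  shows "closed (cspectrum T)"
proof -
  have T: "bounded_clinear (\<lambda>x. - T x)"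
    using bounded_clinear_scale[OF assms, of "-1"] by simp
  have "\<exists>e>0. \<forall>w. dist w z < e \<longrightarrow> w \<in> - cspectrum T" if "z \<in> - cspectrum T" for z
    using that pencil_inverse_exists_nearby[OF T bounded_clinear_id]
    unfolding Compl_iff not_in_cspectrum_iff resolvent_pencil dist_norm by blast
  then show ?thesis
    unfolding closed_def open_dist by blast
qed

lemma continuous_on_resolvent:
  fixes T :: "'a::cbanach \<Rightarrow> 'a"
  shows "continuous_on (- cspectrum T) (\<lambda>z. resolvent T z x)"
proof (rule continuous_on_pencil_inverse)
  show "inverse_operator (\<lambda>x. - T x + z *\<^sub>C x) (resolvent T z)" if "z \<in> - cspectrum T" for z
    using inverse_operator_resolvent[of z T] that unfolding resolvent_pencil by simp
qed (rule bounded_clinear_id)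

section \<open>Polynomials of an operator\<close>

text \<open>Horner's scheme, which makes the rule for \<open>pCons\<close> and hence induction over
  polynomials immediate.\<close>

definition poly_operator :: "complex poly \<Rightarrow> ('a::complex_normed_vector \<Rightarrow> 'a) \<Rightarrow> 'a \<Rightarrow> 'a"
  where "poly_operator p T = fold_coeffs (\<lambda>a g x. a *\<^sub>C x + T (g x)) p (\<lambda>_. 0)"

lemma poly_operator_0 [simp]: "poly_operator 0 T x = 0"
  by (simp add: poly_operator_def)

context
  fixes T :: "'a::complex_normed_vector \<Rightarrow> 'a"
  assumes T: "bounded_clinear T"
begin

lemma poly_operator_pCons [simp]:
  "poly_operator (pCons a p) T x = a *\<^sub>C x + T (poly_operator p T x)"
  \<comment> \<open>\<open>pCons 0 0\<close> is the zero polynomial with no coefficients to fold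
    over, so this case rests on \<open>T 0 = 0\<close>.\<close>
  by (cases "a = 0 \<and> p = 0") (auto simp: poly_operator_def bounded_clinear_simps[OF T])

lemma bounded_clinear_poly_operator: "bounded_clinear (poly_operator p T)"
proof (induction p)
  case 0
  have "poly_operator 0 T = (\<lambda>x. 0)"
    by (rule ext) simp
  then show ?case
    by (simp add: bounded_clinear_zero)
next
  case (pCons a p)
  have "poly_operator (pCons a p) T = (\<lambda>x. a *\<^sub>C x + T (poly_operator p T x))"
    by (rule ext) simp
  then show ?case
    using pCons by (auto intro!: bounded_clinear_add bounded_clinear_scale bounded_clinear_id
        bounded_clinear_compose[OF T])
qed

lemma poly_operator_add: "poly_operator (p + q) T x = poly_operator p T x + poly_operator q T x"
  by (induction p q rule: poly_induct2)
    (simp_all add: bounded_clinear_simps[OF T] scaleC_add_left algebra_simps)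

lemma poly_operator_smult: "poly_operator (smult a p) T x = a *\<^sub>C poly_operator p T x"
  by (induction p) (simp_all add: bounded_clinear_simps[OF T] scaleC_add_right)

lemma poly_operator_mult: "poly_operator (p * q) T x = poly_operator p T (poly_operator q T x)"
  by (induction p) (simp_all add: poly_operator_add poly_operator_smult)

lemma poly_operator_diff: "poly_operator (p - q) T x = poly_operator p T x - poly_operator q T x"
  using poly_operator_add[of "p - q" q x] by simp

lemma poly_operator_sum: "poly_operator (sum f A) T x = (\<Sum>i\<in>A. poly_operator (f i) T x)"
  by (induction A rule: infinite_finite_induct) (simp_all add: poly_operator_add)

end

text \<open>Over the complex numbers \<open>p\<close> splits into linear factors. Each factor
  \<open>a - T\<close> is invertible because its root \<open>a\<close> avoids the spectrum, and
  products of invertible operators are invertible.\<close>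

lemma poly_operator_invertible:
  fixes T :: "'a::cbanach \<Rightarrow> 'a"
  assumes T: "bounded_clinear T" and "p \<noteq> 0" "\<And>w. poly p w = 0 \<Longrightarrow> w \<notin> cspectrum T"
  shows "\<exists>S. inverse_operator (poly_operator p T) S"
  using assms(2,3)
proof (induction "degree p" arbitrary: p)
  case 0
  then obtain c where c: "p = [:c:]" "c \<noteq> 0"
    by (metis degree_eq_zeroE pCons_eq_0_iff)
  have "inverse_operator (poly_operator p T) (\<lambda>x. (1 / c) *\<^sub>C x)"
    unfolding inverse_operator_def using c
    by (auto simp: T bounded_clinear_simps[OF T] intro!: bounded_clinear_scale bounded_clinear_id)
  then show ?case
    by blast
next
  case (Suc n)
  then obtain a where a: "poly p a = 0"
    using alg_closed_imp_poly_has_root[of p] by auto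
  then obtain q where "p = [:-a, 1:] * q"
    by (auto simp: poly_eq_0_iff_dvd)
  \<comment> \<open>The sign moves into the cofactor so that the linear factor has the form
    \<open>a - X\<close> matching \<open>cspectrum\<close>.\<close>
  then have q: "p = [:a, -1:] * (- q)"
    by simp
  then have "degree q = n"
    using Suc(2,3) by (subst (asm) q, subst (asm) degree_mult_eq) auto
  moreover have "- q \<noteq> 0"
    using Suc(3) q by (metis mult_zero_right)
  moreover have "w \<notin> cspectrum T" if "poly (- q) w = 0" for w
    using Suc(4)[of w] that q by (metis poly_mult mult_zero_right)
  ultimately obtain S where "inverse_operator (poly_operator (- q) T) S"
    using Suc(1)[of "- q"] by auto
  moreover have "a \<notin> cspectrum T"
    using Suc(4) a by blast
  then obtain S' where "inverse_operator (\<lambda>x. a *\<^sub>C x - T x) S'"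
    by (auto simp: not_in_cspectrum_iff)
  moreover have "(\<lambda>x. a *\<^sub>C x - T x) = poly_operator [:a, -1:] T"
    by (auto simp: T bounded_clinear_simps[OF T])
  moreover have "poly_operator p T = (\<lambda>x. poly_operator [:a, -1:] T (poly_operator (- q) T x))"
    by (rule ext, subst q, rule poly_operator_mult[OF T])
  ultimately show ?case
    using inverse_operator_compose by metis
qed

section \<open>Normal operators\<close>

lemma holomorphic_ball_imp_has_fps_expansion:
  assumes "f holomorphic_on ball 0 r" "r > 0"
  shows "f has_fps_expansion fps_expansion f 0"
proof (rule analytic_at_imp_has_fps_expansion_0)
  show "f analytic_on {0}"
    using assms by (auto simp: analytic_at intro!: exI[of _ "ball 0 r"])
qed

text \<open>Log-convexity makes the successive ratios nondecreasing, so none drops below the first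
  one, \<open>q\<close>, and \<open>a n\<close> is at least \<open>a 0 * q ^ n\<close>. If
  \<open>q * \<rho>\<close> exceeded 1, \<open>a n * \<rho> ^ n\<close> would be unbounded.\<close>

lemma growth_bound:
  fixes a :: "nat \<Rightarrow> real"
  assumes "\<And>n. a n \<ge> 0" "a 0 > 0" "\<And>n. (a (Suc n))\<^sup>2 \<le> a (Suc (Suc n)) * a n"
    "\<And>n. a n = 0 \<Longrightarrow> a (Suc n) = 0" "\<rho> \<ge> 0" "\<And>n. a n * \<rho> ^ n \<le> M"
  shows "a 1 * \<rho> \<le> a 0"
proof (rule ccontr)
  assume *: "\<not> ?thesis"
  define q where "q = a 1 / a 0"
  have q: "q \<ge> 0"
    using assms(1,2) by (simp add: q_def)
  have step: "q * a n \<le> a (Suc n)" for n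
  proof (induction n)
    case 0
    then show ?case
      using assms(2) by (simp add: q_def)
  next
    case (Suc n)
    show ?case
    proof (cases "a n = 0")
      case True
      then show ?thesis
        using assms(1,4) by simp
    next
      case False
      have "q * a (Suc n) * a n \<le> a (Suc n) * a (Suc n)"
        using mult_right_mono[OF Suc assms(1)[of "Suc n"]] by (simp add: mult_ac)
      also have "\<dots> \<le> a (Suc (Suc n)) * a n"
        using assms(3)[of n] by (simp add: power2_eq_square)
      finally show ?thesis
        using False assms(1)[of n] by simp
    qed
  qed
  have lower: "a 0 * q ^ n \<le> a n" for n
  proof (induction n)
    case (Suc n)
    show ?case
      using mult_left_mono[OF Suc q] step[of n] by (simp add: mult_ac)
  qed simp
  have "1 < q * \<rho>"
    using * assms(2) by (simp add: q_def field_simps)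
  then obtain n where n: "M / a 0 < (q * \<rho>) ^ n"
    using real_arch_pow by blast
  have "a 0 * (q * \<rho>) ^ n \<le> a n * \<rho> ^ n"
    using mult_right_mono[OF lower, of "\<rho> ^ n" n] assms(5) by (simp add: power_mult_distrib mult_ac)
  then show False
    using n assms(6)[of n] assms(2) by (simp add: field_simps)
qed

text \<open>The Taylor coefficients at \<open>0\<close> of \<open>z \<mapsto> cinner ((I - z N)\<^sup>-\<^sup>1 x) y\<close> are
  \<open>cinner (N\<^sup>n x) y\<close>, so Cauchy's inequality limits the growth of \<open>norm (N\<^sup>n x)\<close>.\<close>

lemma norm_funpow_bound:
  fixes N :: "'a::chilbert_space \<Rightarrow> 'a"
  assumes N: "bounded_clinear N" and \<rho>: "0 < \<rho>" "\<rho> < r"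
    and inv: "\<And>z. cmod z < r \<Longrightarrow> \<exists>S. inverse_operator (\<lambda>x. x - z *\<^sub>C N x) S"
  shows "\<exists>M. \<forall>n. norm ((N ^^ n) x) * \<rho> ^ n \<le> M"
proof -
  obtain G where G: "\<And>z. z \<in> ball 0 r \<Longrightarrow> inverse_operator (\<lambda>x. x - z *\<^sub>C N x) (G z)"
    using inv by (auto simp: dist_norm) metis
  define B where "B = (\<lambda>x. - N x)"
  have B: "bounded_clinear B"
    using bounded_clinear_scale[OF N, of "-1"] by (simp add: B_def)
  have G': "inverse_operator (\<lambda>x. x + z *\<^sub>C B x) (G z)" if "z \<in> ball 0 r" for z
    using G[OF that] by (simp add: B_def)
  \<comment> \<open>The index \<open>n\<close> shifts the starting vector to
    \<open>(N ^^ n) x\<close>; this lets the Taylor coefficients be found by recursion.\<close>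
  define f where "f = (\<lambda>y n z. cinner (G z ((N ^^ n) x)) y)"
  have "bounded_clinear (\<lambda>v. cinner v y)" for y :: 'a
    using cauchy_schwarz[of _ y]
    by (intro bounded_clinearI[of _ "norm y"]) (auto simp: cinner_simps scaleC_complex_def mult.commute)
  from holomorphic_on_pencil_inverse[OF this B G']
  have hol: "f y n holomorphic_on ball 0 r" for y n
    unfolding f_def .
  \<comment> \<open>This is the resolvent equation \<open>G z v = v + z *\<^sub>C G z (N v)\<close>:
    splitting off the constant term leaves \<open>z\<close> times the next function.\<close>
  have rec: "f y n z = cinner ((N ^^ n) x) y + z * f y (Suc n) z" if "z \<in> ball 0 r" for y n z
  proof -
    note bG = inverse_operatorD(1)[OF G[OF that]]
    have "G z v = v + z *\<^sub>C G z (N v)" for v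
      using inverse_operatorD(2)[OF G[OF that], of v]
      by (simp add: bounded_clinear_simps[OF bG] algebra_simps)
    from this[of "(N ^^ n) x"] show ?thesis
      by (simp add: f_def cinner_simps flip: cinner_add_left cinner_scaleC_left)
  qed
  have expand: "f y n has_fps_expansion fps_expansion (f y n) 0" for y n
    using holomorphic_ball_imp_has_fps_expansion[OF hol] \<rho> by simp
  have coeff_rec: "fps_expansion (f y n) 0
      = fps_const (cinner ((N ^^ n) x) y) + fps_X * fps_expansion (f y (Suc n)) 0" for y n
  proof (rule fps_expansion_unique_complex[OF expand])
    have "(\<lambda>z. cinner ((N ^^ n) x) y + z * f y (Suc n) z) has_fps_expansion
        fps_const (cinner ((N ^^ n) x) y) + fps_X * fps_expansion (f y (Suc n)) 0"
      by (intro has_fps_expansion_add has_fps_expansion_mult has_fps_expansion_const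
          has_fps_expansion_fps_X expand)
    moreover have "\<forall>\<^sub>F z in nhds 0. f y n z = cinner ((N ^^ n) x) y + z * f y (Suc n) z"
      using \<rho> by (intro eventually_mono[OF eventually_nhds_in_open[of "ball 0 r" 0]] rec) auto
    ultimately show "f y n has_fps_expansion
        fps_const (cinner ((N ^^ n) x) y) + fps_X * fps_expansion (f y (Suc n)) 0"
      by (subst has_fps_expansion_cong[OF _ refl])
  qed
  have coeff: "fps_nth (fps_expansion (f y m) 0) n = cinner ((N ^^ (n + m)) x) y" for y n m
  proof (induction n arbitrary: m)
    case 0
    show ?case
      by (subst coeff_rec) simp
  next
    case (Suc n)
    show ?case
      by (subst coeff_rec) (simp add: Suc del: funpow.simps)
  qed
  \<comment> \<open>The bound \<open>M\<close> is uniform over the closed disc and does not depend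
    on \<open>n\<close> or on the test vector \<open>y\<close>.\<close>
  have "compact ((\<lambda>z. G z x) ` cball 0 \<rho>)"
    using \<rho> continuous_on_subset[OF continuous_on_pencil_inverse[OF B G'], of "cball 0 \<rho>"]
    by (intro compact_continuous_image) auto
  then have "\<exists>M. \<forall>z\<in>cball 0 \<rho>. norm (G z x) \<le> M"
    by (auto dest!: compact_imp_bounded simp: bounded_iff)
  then obtain M where M: "\<And>z. z \<in> cball 0 \<rho> \<Longrightarrow> norm (G z x) \<le> M"
    by blast
  have "norm ((N ^^ n) x) * \<rho> ^ n \<le> M" for n
  proof -
    \<comment> \<open>With this test vector the \<open>n\<close>-th coefficient is the square of
      \<open>norm y\<close>, and one factor cancels against the \<open>norm y\<close> in Cauchy's
      estimate.\<close>
    define y where "y = (N ^^ n) x"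
    have "cmod ((deriv ^^ n) (f y 0) 0) \<le> fact n * (M * norm y) / \<rho> ^ n"
    proof (rule Cauchy_inequality)
      show "f y 0 holomorphic_on ball 0 \<rho>"
        using \<rho> by (intro holomorphic_on_subset[OF hol]) auto
      show "continuous_on (cball 0 \<rho>) (f y 0)"
        using \<rho> by (intro continuous_on_subset[OF holomorphic_on_imp_continuous_on[OF hol]]) auto
      fix z :: complex
      assume "cmod (0 - z) = \<rho>"
      then have "norm (G z x) * norm y \<le> M * norm y"
        by (intro mult_right_mono M) auto
      then show "cmod (f y 0 z) \<le> M * norm y"
        using cauchy_schwarz[of "G z x" y] by (simp add: f_def)
    qed fact
    moreover have "(deriv ^^ n) (f y 0) 0 = fact n * cinner y y"
      using fps_nth_fps_expansion[OF expand[of y 0], of n] coeff[of y 0 n]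
      by (simp add: divide_eq_eq mult.commute flip: y_def)
    ultimately have "fact n * (norm y)\<^sup>2 \<le> fact n * (M * norm y) / \<rho> ^ n"
      by (simp add: cinner_norm norm_mult norm_power)
    then have "norm y * \<rho> ^ n * norm y \<le> M * norm y"
      using \<rho> by (simp add: field_simps power2_eq_square)
    moreover have "0 \<le> M"
      using order_trans[OF norm_ge_zero M[of 0]] \<rho> by simp
    ultimately show ?thesis
      by (cases "y = 0") (auto simp: y_def mult.commute)
  qed
  then show ?thesis
    by blast
qed

text \<open>Along the orbit of \<open>x\<close> the hypothesis \<open>sq\<close> is log-convexity of
  the norms, while invertibility on the disc limits their growth. Thus \<open>growth_bound\<close>
  controls the first ratio for each \<rho> below \<open>r\<close>, and \<rho> tends to
  \<open>r\<close>.\<close>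

lemma norm_le_if_invertible:
  fixes N :: "'a::chilbert_space \<Rightarrow> 'a"
  assumes N: "bounded_clinear N" and r: "0 < r"
    and inv: "\<And>z. cmod z < r \<Longrightarrow> \<exists>S. inverse_operator (\<lambda>x. x - z *\<^sub>C N x) S"
    and sq: "\<And>x. (norm (N x))\<^sup>2 \<le> norm (N (N x)) * norm x"
  shows "norm (N x) * r \<le> norm x"
proof (cases "N x = 0")
  case False
  have le: "norm (N x) * \<rho> \<le> norm x" if \<rho>: "0 < \<rho>" "\<rho> < r" for \<rho>
  proof -
    obtain M where "\<And>n. norm ((N ^^ n) x) * \<rho> ^ n \<le> M"
      using norm_funpow_bound[OF N \<rho> inv] by metis
    moreover have "x \<noteq> 0"
      using False by (auto simp: bounded_clinear_simps[OF N])
    ultimately show ?thesis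
      using growth_bound[of "\<lambda>n. norm ((N ^^ n) x)" \<rho> M] sq[of "(N ^^ _) x"] \<rho>
      by (auto simp: bounded_clinear_simps[OF N])
  qed
  have "r \<le> norm x / norm (N x)"
    using r le False by (intro dense_le_bounded[of 0 r]) (auto simp: field_simps)
  then show ?thesis
    using False by (simp add: field_simps)
qed simp

text \<open>Cauchy-Schwarz bounds \<open>cinner (N' (N x)) x\<close>, and commutation makes
  \<open>N'\<close> and \<open>N\<close> equal in norm at every vector, here at
  \<open>N x\<close>.\<close>

lemma normal_norm_square:
  fixes N :: "'a::chilbert_space \<Rightarrow> 'a"
  assumes N': "\<And>x y. cinner (N x) y = cinner x (N' y)" and comm: "\<And>x. N (N' x) = N' (N x)"
  shows "(norm (N x))\<^sup>2 \<le> norm (N (N x)) * norm x"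
proof -
  have N'2: "cinner (N' x) y = cinner x (N y)" for x y
    by (metis N' cinner_commute)
  have eq: "norm (N' x) = norm (N x)" for x
  proof -
    have "cinner (N' x) (N' x) = cinner (N x) (N x)"
      by (simp add: N'2 N' comm)
    then have "complex_of_real ((norm (N' x))\<^sup>2) = complex_of_real ((norm (N x))\<^sup>2)"
      by (simp only: cinner_norm)
    then have "(norm (N' x))\<^sup>2 = (norm (N x))\<^sup>2"
      using of_real_eq_iff by blast
    then show ?thesis
      by simp
  qed
  have "(norm (N x))\<^sup>2 = cmod (cinner (N x) (N x))"
    by (simp add: cinner_norm norm_power)
  also have "\<dots> = cmod (cinner (N' (N x)) x)"
    by (simp add: N'2)
  also have "\<dots> \<le> norm (N (N x)) * norm x"
    using cauchy_schwarz[of "N' (N x)" x] by (simp add: eq)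
  finally show ?thesis .
qed

section \<open>Linear combinations of resolvents\<close>

lemma inverse_operator_commute:
  assumes "inverse_operator A S" "\<And>x. A (C x) = C (A x)"
  shows "S (C x) = C (S x)"
  using assms by (metis inverse_operatorD(2,3))

text \<open>If \<open>Q\<close> is the product of the \<open>p - X\<close> over \<open>p \<in> P\<close> and \<open>D = Q - z * (\<Sum>p\<in>P. c p * (Q / (p - X)))\<close>,
  then \<open>Q(T) (I - z N) = D(T)\<close>.\<close>

lemma resolvent_combination_invertible:
  fixes T :: "'a::cbanach \<Rightarrow> 'a" and c :: "complex \<Rightarrow> complex"
  assumes T: "bounded_clinear T" and P: "finite P" "P \<inter> cspectrum T = {}"
    and nz: "\<And>w. w \<in> cspectrum T \<Longrightarrow> z * (\<Sum>p\<in>P. c p / (p - w)) \<noteq> 1"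
  shows "\<exists>S. inverse_operator (\<lambda>x. x - z *\<^sub>C (\<Sum>p\<in>P. c p *\<^sub>C resolvent T p x)) S"
proof -
  define q where "q = (\<lambda>p. [:p, -1:] :: complex poly)"
  define Q where "Q = prod q P"
  define Q' where "Q' = (\<lambda>p. prod q (P - {p}))"
  define D where "D = Q - smult z (\<Sum>p\<in>P. smult (c p) (Q' p))"
  have QQ': "Q = Q' p * q p" if "p \<in> P" for p
    using that P(1) by (simp add: Q_def Q'_def prod.remove mult.commute)
  have poly_q: "poly (q p) w = p - w" for p w
    by (simp add: q_def)
  have poly_Q: "poly Q w = 0 \<longleftrightarrow> w \<in> P" for w
    using P(1) by (auto simp: Q_def poly_prod poly_q)
  have poly_Q': "poly (Q' p) w = poly Q w / (p - w)" if "p \<in> P" "w \<notin> P" for p w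
    using that QQ'[OF that(1)] by (auto simp: poly_q)
  \<comment> \<open>Off \<open>P\<close> the value of \<open>D\<close> is \<open>poly Q w\<close>
    times one minus \<open>z\<close> times the symbol; on the spectrum both factors are
    nonzero.\<close>
  have D_root: "w \<notin> cspectrum T" if "poly D w = 0" for w
  proof
    assume w: "w \<in> cspectrum T"
    then have "w \<notin> P"
      using P(2) by blast
    then have "poly D w = poly Q w * (1 - z * (\<Sum>p\<in>P. c p / (p - w)))"
      by (simp add: D_def poly_sum poly_Q' sum_distrib_left algebra_simps cong: sum.cong)
    then show False
      using that nz[OF w] poly_Q[of w] \<open>w \<notin> P\<close> by simp
  qed
  \<comment> \<open>If some \<open>z * c p\<close> is nonzero, evaluation at that \<open>p\<close>
    kills \<open>Q\<close> and all other summands; otherwise \<open>D\<close> is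
    \<open>Q\<close>.\<close>
  have "D \<noteq> 0"
  proof (cases "\<exists>p\<in>P. z * c p \<noteq> 0")
    case True
    then obtain p where p: "p \<in> P" "z \<noteq> 0" "c p \<noteq> 0"
      by auto
    have "poly (Q' r) p = 0" if "r \<in> P - {p}" for r
      using that p P(1) by (auto simp: Q'_def poly_prod poly_q)
    then have "poly (\<Sum>r\<in>P. smult (c r) (Q' r)) p = c p * poly (Q' p) p"
      using p P(1) by (simp add: poly_sum sum.remove[of P p])
    moreover have "poly (Q' p) p \<noteq> 0"
      using P(1) by (auto simp: Q'_def poly_prod poly_q)
    moreover have "poly Q p = 0"
      using p poly_Q by simp
    ultimately have "poly D p \<noteq> 0"
      using p by (simp add: D_def)
    then show ?thesis
      by auto
  next
    case False
    then have "smult z (\<Sum>p\<in>P. smult (c p) (Q' p)) = 0"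
      by (cases "z = 0") (auto intro!: sum.neutral)
    moreover have "Q \<noteq> 0"
      using P(1) by (auto simp: Q_def q_def)
    ultimately show ?thesis
      by (metis D_def diff_zero)
  qed
  then obtain SD where SD: "inverse_operator (poly_operator D T) SD"
    using poly_operator_invertible[OF T] D_root by blast
  have "Q \<noteq> 0"
    using P(1) by (auto simp: Q_def q_def)
  then obtain SQ where SQ: "inverse_operator (poly_operator Q T) SQ"
    using poly_operator_invertible[OF T, of Q] poly_Q P(2) by auto
  define N where "N = (\<lambda>x. \<Sum>p\<in>P. c p *\<^sub>C resolvent T p x)"
  note bQ = bounded_clinear_poly_operator[OF T, of Q]
  have Q'_resolvent: "poly_operator Q T (resolvent T p x) = poly_operator (Q' p) T x" if p: "p \<in> P" for p x
  proof -
    have "p \<notin> cspectrum T"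
      using p P(2) by blast
    moreover have "poly_operator (q p) T y = p *\<^sub>C y - T y" for y
      by (simp add: q_def T bounded_clinear_simps[OF T])
    ultimately show ?thesis
      using inverse_operatorD(3)[OF inverse_operator_resolvent, of p T x]
      by (simp add: QQ'[OF p] poly_operator_mult[OF T])
  qed
  have QD: "poly_operator Q T (x - z *\<^sub>C N x) = poly_operator D T x" for x
    by (simp add: N_def D_def bounded_clinear_simps[OF bQ] Q'_resolvent poly_operator_diff[OF T]
        poly_operator_smult[OF T] poly_operator_sum[OF T])
  have "inverse_operator (\<lambda>x. x - z *\<^sub>C N x) (\<lambda>x. SD (poly_operator Q T x))"
    unfolding inverse_operator_def
  proof (intro conjI allI)
    show "bounded_clinear (\<lambda>x. SD (poly_operator Q T x))"
      by (rule bounded_clinear_compose[OF inverse_operatorD(1)[OF SD] bQ])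
    fix x
    show "SD (poly_operator Q T (x - z *\<^sub>C N x)) = x"
      unfolding QD by (rule inverse_operatorD(2)[OF SD])
    \<comment> \<open>For the right inverse, \<open>Q(T)\<close> is applied to both sides and then
      cancelled on the left by means of \<open>SQ\<close>.\<close>
    have "poly_operator Q T (SD (poly_operator Q T x) - z *\<^sub>C N (SD (poly_operator Q T x))) = poly_operator Q T x"
      unfolding QD by (rule inverse_operatorD(3)[OF SD])
    then show "SD (poly_operator Q T x) - z *\<^sub>C N (SD (poly_operator Q T x)) = x"
      by (metis inverse_operatorD(2)[OF SQ])
  qed
  then show ?thesis
    unfolding N_def by blast
qed

text \<open>For \<open>z\<close> inside the disc of radius \<open>1 / K\<close>, the product of
  \<open>z\<close> and the symbol cannot reach 1 on the spectrum, so \<open>I - z N\<close> is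
  invertible there. Normality of \<open>N\<close> then turns this into the norm bound.\<close>

lemma normal_resolvent_combination_bound:
  fixes T :: "'a::chilbert_space \<Rightarrow> 'a" and c :: "complex \<Rightarrow> complex"
  assumes T: "bounded_clinear T" and normal: "normal_operator T"
    and P: "finite P" "P \<inter> cspectrum T = {}"
    and K: "0 < K" "\<And>w. w \<in> cspectrum T \<Longrightarrow> cmod (\<Sum>p\<in>P. c p / (p - w)) \<le> K"
  shows "norm (\<Sum>p\<in>P. c p *\<^sub>C resolvent T p x) \<le> K * norm x"
proof -
  define N where "N = (\<lambda>x. \<Sum>p\<in>P. c p *\<^sub>C resolvent T p x)"
  have res: "inverse_operator (\<lambda>x. p *\<^sub>C x - T x) (resolvent T p)" if "p \<in> P" for p
    using P(2) that by (intro inverse_operator_resolvent) blast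
  have N: "bounded_clinear N"
    unfolding N_def by (intro bounded_clinear_sum bounded_clinear_scale inverse_operatorD(1)[OF res])
  obtain N' where N': "\<And>x y. cinner (N x) y = cinner x (N' y)" "bounded_clinear N'"
    using adjoint_exists[OF N] by blast
  \<comment> \<open>Used twice to show that \<open>N\<close> is normal: for the adjoint of
    \<open>T\<close>, which commutes with \<open>T\<close> by hypothesis, and then for
    \<open>N'\<close>, which commutes with \<open>T\<close> by taking adjoints in the first
    relation.\<close>
  have N_commute: "N (C x) = C (N x)" if C: "bounded_clinear C" "\<And>x. T (C x) = C (T x)" for C x
  proof -
    have "resolvent T p (C x) = C (resolvent T p x)" if "p \<in> P" for p x
      by (rule inverse_operator_commute[OF res[OF that]]) (simp add: C(2) bounded_clinear_simps[OF C(1)])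
    then show ?thesis
      by (simp add: N_def bounded_clinear_simps[OF C(1)])
  qed
  have "T (cadjoint T x) = cadjoint T (T x)" for x
    using normal by (metis comp_apply normal_operator_def)
  from N_commute[OF cadjoint(2)[OF T] this]
  have adj: "N (cadjoint T x) = cadjoint T (N x)" for x .
  have "T (N' x) = N' (T x)" for x
  proof (rule cinner_ext)
    fix u
    have "cinner u (T (N' x)) = cinner (cadjoint T u) (N' x)"
      by (metis cadjoint(1)[OF T] cinner_commute)
    also have "\<dots> = cinner (cadjoint T (N u)) x"
      by (simp add: adj flip: N'(1))
    also have "\<dots> = cinner (N u) (T x)"
      by (metis cadjoint(1)[OF T] cinner_commute)
    finally show "cinner u (T (N' x)) = cinner u (N' (T x))"
      by (simp add: N'(1))
  qed
  from N_commute[OF N'(2) this] have "N (N' x) = N' (N x)" for x .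
  then have sq: "(norm (N x))\<^sup>2 \<le> norm (N (N x)) * norm x" for x
    by (rule normal_norm_square[OF N'(1)])
  have "norm (N x) * (1 / K) \<le> norm x"
  proof (rule norm_le_if_invertible[OF N _ _ sq])
    fix z assume z: "cmod z < 1 / K"
    have "z * (\<Sum>p\<in>P. c p / (p - w)) \<noteq> 1" if "w \<in> cspectrum T" for w
    proof
      assume "z * (\<Sum>p\<in>P. c p / (p - w)) = 1"
      then have "1 = cmod z * cmod (\<Sum>p\<in>P. c p / (p - w))"
        by (metis norm_mult norm_one)
      also have "\<dots> \<le> cmod z * K"
        by (intro mult_left_mono K(2) that) simp
      also have "\<dots> < 1"
        using z K(1) by (simp add: field_simps)
      finally show False
        by simp
    qed
    then show "\<exists>S. inverse_operator (\<lambda>x. x - z *\<^sub>C N x) S"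
      unfolding N_def by (intro resolvent_combination_invertible T P) auto
  qed (use K in simp)
  then show ?thesis
    using K(1) by (simp add: N_def field_simps)
qed

section \<open>Integration\<close>

text \<open>The bound compares \<open>1 / norm (z - w)\<close> with a sum of indicators of dyadic discs around \<open>w\<close>.\<close>

lemma inverse_distance_integral_bound:
  fixes B :: "complex set"
  assumes B: "B \<in> sets borel" "emeasure lborel B < \<infinity>"
  obtains C where "C > 0"
    "\<And>w. (\<integral>\<^sup>+ z\<in>B. ennreal (1 / cmod (z - w)) \<partial>lborel) \<le> ennreal C"
proof -
  \<comment> \<open>The disc of radius \<open>(1/2) ^ k\<close> with weight \<open>2 ^ Suc k\<close>
    contributes \<open>2 * pi * (1/2) ^ k\<close>, in total \<open>4 * pi\<close>. The measure of
    \<open>B\<close> pays for the points at distance at least 1, where the integrand is at most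
    1.\<close>
  define C where "C = 4 * pi + measure lborel B"
  have "(\<integral>\<^sup>+ z\<in>B. ennreal (1 / cmod (z - w)) \<partial>lborel) \<le> ennreal C" for w :: complex
  proof -
    have le: "ennreal (1 / cmod (z - w)) * indicator B z \<le>
        (\<Sum>k. ennreal (2 ^ Suc k) * indicator (cball w ((1/2) ^ k)) z) + indicator B z" for z
    \<comment> \<open>At \<open>z = w\<close> the quotient has the default value 0.\<close>
    proof (cases "z = w \<or> z \<notin> B \<or> 1 \<le> cmod (z - w)")
      case True
      then show ?thesis
        by (auto simp: divide_le_eq_1 intro!: add_increasing split: split_indicator)
    next
      case False
      then have d: "0 < cmod (z - w)" "cmod (z - w) < 1" "z \<in> B"
        by auto
      define h where "h = (\<lambda>k. ennreal (2 ^ Suc k) * indicator (cball w ((1/2) ^ k)) z)"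
      \<comment> \<open>This choice places \<open>z\<close> in the annulus around \<open>w\<close>
        between the radii \<open>(1/2) ^ Suc k\<close> and \<open>(1/2) ^ k\<close>, so a single
        term of the series suffices.\<close>
      define k where "k = (LEAST k. (1/2) ^ Suc k \<le> cmod (z - w))"
      obtain n where "(1/2) ^ n < cmod (z - w)"
        using real_arch_pow_inv[OF d(1), of "1/2"] by auto
      moreover have "(1/2 :: real) ^ Suc n \<le> (1/2) ^ n"
        by simp
      ultimately have "(1/2) ^ Suc n \<le> cmod (z - w)"
        by linarith
      then have k: "(1/2) ^ Suc k \<le> cmod (z - w)"
        unfolding k_def by (rule LeastI)
      have k': "cmod (z - w) \<le> (1/2) ^ k"
      proof (cases k)
        case 0
        then show ?thesis
          using d by simp
      next
        case (Suc j)
        then have "\<not> (1/2) ^ Suc j \<le> cmod (z - w)"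
          unfolding k_def by (metis lessI not_less_Least)
        then show ?thesis
          using Suc by simp
      qed
      have "1 / cmod (z - w) \<le> 1 / (1/2) ^ Suc k"
        using k d by (intro divide_left_mono) auto
      also have "\<dots> = 2 ^ Suc k"
        by (simp add: power_one_over)
      finally have "ennreal (1 / cmod (z - w)) * indicator B z \<le>
h k"
        using d(3) k' by (simp add: h_def dist_norm norm_minus_commute ennreal_leI del: power_Suc)
      also have "h k \<le> suminf h"
        using sum_le_suminf[of h "{k}"] by simp
      finally show ?thesis
        by (simp add: h_def add_increasing2)
    qed
    have disc: "(\<integral>\<^sup>+ z. ennreal (2 ^ Suc k) * indicator (cball w ((1/2) ^ k)) z \<partial>lborel) =
        ennreal (2 * pi * (1/2) ^ k)" for k
    proof -
      have "(2::real) ^ Suc k * (pi * ((1/2) ^ k)\<^sup>2) = 2 * pi * (1/2) ^ k * (2 ^ k * (1/2) ^ k)"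
        by (simp add: power2_eq_square)
      also have "(2::real) ^ k * (1/2) ^ k = 1"
        by (simp flip: power_mult_distrib)
      finally show ?thesis
        by (simp add: nn_integral_cmult_indicator emeasure_cball unit_ball_vol_2
            flip: ennreal_mult del: power_Suc)
    qed
    have meas: "(\<lambda>z. ennreal (2 ^ Suc k) * indicator (cball w ((1/2) ^ k)) z) \<in> borel_measurable lborel" for k
      by (intro borel_measurable_times_ennreal borel_measurable_indicator borel_measurable_const) simp
    have "(\<integral>\<^sup>+ z\<in>B. ennreal (1 / cmod (z - w)) \<partial>lborel) \<le>
        (\<integral>\<^sup>+ z. (\<Sum>k. ennreal (2 ^ Suc k) * indicator (cball w ((1/2) ^ k)) z) + indicator B z \<partial>lborel)"
      by (intro nn_integral_mono le)
    also have "\<dots> = (\<Sum>k. \<integral>\<^sup>+ z. ennreal (2 ^ Suc k) * indicator (cball w ((1/2) ^ k)) z \<partial>lborel) + emeasure lborel B"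
      using B(1)
      by (simp add: nn_integral_add[OF borel_measurable_suminf_order[OF meas]] nn_integral_suminf[OF meas]
          del: power_Suc)
    also have "\<dots> = (\<Sum>k. ennreal (2 * pi * (1/2) ^ k)) + emeasure lborel B"
      by (simp only: disc)
    also have "(\<Sum>k. ennreal (2 * pi * (1/2) ^ k)) = ennreal (2 * pi * 2)"
      using sums_mult[OF geometric_sums[of "1/2 :: real"], of "2 * pi"] by (intro suminf_ennreal_eq) auto
    also have "emeasure lborel B = ennreal (measure lborel B)"
      using B by (intro emeasure_eq_ennreal_measure) auto
    finally show ?thesis
      by (simp add: C_def flip: ennreal_plus)
  qed
  moreover have "C > 0"
    by (simp add: C_def add_pos_nonneg)
  ultimately show thesis
    using that by blast
qed

text \<open>Approximating the identity by simple functions turns the integral into finite sums. A sample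
  point is only used where it is closer to \<open>z\<close> than to the complement of \<open>U\<close>, so that its
  distance from a point outside \<open>U\<close> is at least half that of \<open>z\<close>.\<close>

lemma nn_integral_bound_by_finite_sums:
  fixes F :: "complex \<Rightarrow> complex"
  assumes U: "open U" "bounded U" and F: "continuous_on U F" and V: "V \<inter> U = {}"
    and C: "C \<ge> 0" "\<And>w. (\<integral>\<^sup>+ z\<in>U. ennreal (1 / cmod (z - w)) \<partial>lborel) \<le> ennreal C"
    and sums: "\<And>P m. finite P \<Longrightarrow> P \<subseteq> U \<Longrightarrow> (\<And>p. p \<in> P \<Longrightarrow> 0 \<le> m p) \<Longrightarrow>
      (\<And>w. w \<in> V \<Longrightarrow> (\<Sum>p\<in>P. m p / cmod (p - w)) \<le> 2 * C) \<Longrightarrow> (\<Sum>p\<in>P. m p * cmod (F p)) \<le> K"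
  shows "(\<integral>\<^sup>+ z\<in>U. ennreal (cmod (F z)) \<partial>lborel) \<le> ennreal K"
proof -
  have [measurable]: "U \<in> sets borel"
    using U(1) by simp
  have finU: "emeasure lborel U < \<infinity>"
    by (rule emeasure_bounded_finite[OF U(2)])
  obtain g :: "nat \<Rightarrow> complex \<Rightarrow> complex" where g: "\<And>i. simple_function lborel (g i)"
    "\<And>z. (\<lambda>i. g i z) \<longlonglongrightarrow> z"
    using borel_measurable_implies_sequence_metric[of "\<lambda>z. z" "lborel :: complex measure" 0] by auto
  note [measurable] = borel_measurable_simple_function[OF g(1)]
  have gB[measurable]: "g i \<in> borel_measurable borel" for i
    using borel_measurable_simple_function[OF g(1)[of i]] by simp
  define E where "E = (\<lambda>i. {z\<in>U. cmod (g i z - z) < infdist (g i z) (- U)})"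
  have E[measurable]: "E i \<in> sets borel" for i
  proof -
    have "(\<lambda>z. infdist z (- U)) \<in> borel_measurable borel"
      by (intro borel_measurable_continuous_onI continuous_on_infdist continuous_on_id)
    from measurable_compose[OF gB this]
    have [measurable]: "(\<lambda>z. infdist (g i z) (- U)) \<in> borel_measurable borel" for i .
    show ?thesis
      unfolding E_def by measurable
  qed
  have gU: "g i z \<in> U" if "z \<in> E i" for i z
  proof (rule ccontr)
    assume "g i z \<notin> U"
    then have "infdist (g i z) (- U) = 0"
      by simp
    then show False
      using that by (auto simp: E_def)
  qed
  \<comment> \<open>The sample point is closer to \<open>z\<close> than to \<open>w\<close>, so the
    triangle inequality through it loses at most a factor 2.\<close>
  have g_dist: "1 / cmod (g i z - w) \<le> 2 * (1 / cmod (z - w))" if "z \<in> E i" "w \<notin> U" for i z w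
  proof -
    have "cmod (g i z - z) < cmod (g i z - w)"
      using that infdist_le[of w "- U" "g i z"] by (auto simp: E_def dist_norm)
    then have "cmod (z - w) \<le> 2 * cmod (g i z - w)"
      using norm_triangle_ineq4[of "g i z - w" "g i z - z"] by simp
    moreover have "0 < cmod (z - w)" "0 < cmod (g i z - w)"
      using that gU[OF that(1)] by (auto simp: E_def)
    ultimately show ?thesis
      by (simp add: field_simps)
  qed
  define P where "P = (\<lambda>i. g i ` E i)"
  have finP: "finite (P i)" for i
    unfolding P_def using simple_functionD(1)[OF g(1), of i] by (rule finite_subset[rotated]) auto
  define A where "A = (\<lambda>i p. {z\<in>E i. g i z = p})"
  have A[measurable]: "A i p \<in> sets borel" for i p
    unfolding A_def by measurable
  \<comment> \<open>Since \<open>g i\<close> takes finitely many values, integrating a function of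
    \<open>g i z\<close> is summing over sample points weighted by the measures of the level
    sets.\<close>
  have sum_eq: "(\<integral>\<^sup>+ z\<in>E i. ennreal (\<phi> (g i z)) \<partial>lborel) = ennreal (\<Sum>p\<in>P i. measure lborel (A i p) * \<phi> p)"
    if \<phi>: "\<And>p. 0 \<le> \<phi> p" for i and \<phi> :: "complex \<Rightarrow> real"
  proof -
    have "ennreal (\<phi> (g i z)) * indicator (E i) z = (\<Sum>p\<in>P i. ennreal (\<phi> p) * indicator (A i p) z)" for z
    proof (cases "z \<in> E i")
      case True
      then have "(\<Sum>p\<in>P i. ennreal (\<phi> p) * indicator (A i p) z) = (\<Sum>p\<in>{g i z}. ennreal (\<phi> p) * indicator (A i p) z)"
        using finP[of i] by (intro sum.mono_neutral_right) (auto simp: P_def A_def)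
      with True show ?thesis
        by (simp add: A_def)
    qed (simp add: A_def)
    then have "(\<integral>\<^sup>+ z\<in>E i. ennreal (\<phi> (g i z)) \<partial>lborel) = (\<Sum>p\<in>P i. ennreal (\<phi> p) * emeasure lborel (A i p))"
      by (simp add: nn_integral_sum nn_integral_cmult_indicator)
    also have "\<dots> = (\<Sum>p\<in>P i. ennreal (measure lborel (A i p) * \<phi> p))"
    proof (intro sum.cong refl)
      fix p
      have "emeasure lborel (A i p) \<le> emeasure lborel U"
        by (intro emeasure_mono) (auto simp: A_def E_def)
      then have "emeasure lborel (A i p) = ennreal (measure lborel (A i p))"
        using finU by (intro emeasure_eq_ennreal_measure) auto
      then show "ennreal (\<phi> p) * emeasure lborel (A i p) = ennreal (measure lborel (A i p) * \<phi> p)"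
        using \<phi> by (simp add: ennreal_mult mult.commute)
    qed
    also have "\<dots> = ennreal (\<Sum>p\<in>P i. measure lborel (A i p) * \<phi> p)"
      using \<phi> by (intro sum_ennreal) auto
    finally show ?thesis .
  qed
  have bound: "(\<integral>\<^sup>+ z\<in>E i. ennreal (cmod (F (g i z))) \<partial>lborel) \<le> ennreal K" for i
  proof -
    \<comment> \<open>The weights meet the hypothesis of \<open>sums\<close>: read backwards, the
      sum is an integral over \<open>E i\<close>, at most twice the one bounded by
      \<open>C\<close>.\<close>
    have "(\<Sum>p\<in>P i. measure lborel (A i p) / cmod (p - w)) \<le> 2 * C" if w: "w \<in> V" for w
    proof -
      have "w \<notin> U"
        using w V by blast
      have "ennreal (\<Sum>p\<in>P i. measure lborel (A i p) * (1 / cmod (p - w))) =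
          (\<integral>\<^sup>+ z\<in>E i. ennreal (1 / cmod (g i z - w)) \<partial>lborel)"
        by (rule sum_eq[symmetric]) simp
      also have "\<dots> \<le> (\<integral>\<^sup>+ z. 2 * (ennreal (1 / cmod (z - w)) * indicator U z) \<partial>lborel)"
      proof (rule nn_integral_mono)
        fix z
        show "ennreal (1 / cmod (g i z - w)) * indicator (E i) z \<le> 2 * (ennreal (1 / cmod (z - w)) * indicator U z)"
        proof (cases "z \<in> E i")
          case True
          then have "z \<in> U"
            by (simp add: E_def)
          moreover have "ennreal (1 / cmod (g i z - w)) \<le> ennreal (2 * (1 / cmod (z - w)))"
            by (intro ennreal_leI g_dist True \<open>w \<notin> U\<close>)
          then have "ennreal (1 / cmod (g i z - w)) \<le> 2 * ennreal (1 / cmod (z - w))"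
            by (subst (asm) ennreal_mult) auto
          ultimately show ?thesis
            using True by simp
        qed simp
      qed
      also have "\<dots> = 2 * (\<integral>\<^sup>+ z\<in>U. ennreal (1 / cmod (z - w)) \<partial>lborel)"
        by (rule nn_integral_cmult) measurable
      also have "\<dots> \<le> 2 * ennreal C"
        by (intro mult_left_mono C) simp
      also have "\<dots> = ennreal (2 * C)"
        using C(1) by (simp add: ennreal_mult)
      finally show ?thesis
        using C(1) by (simp add: ennreal_le_iff)
    qed
    moreover have "P i \<subseteq> U"
      using gU by (auto simp: P_def)
    ultimately have "(\<Sum>p\<in>P i. measure lborel (A i p) * cmod (F p)) \<le> K"
      using finP by (intro sums) auto
    then show ?thesis
      by (subst sum_eq[of "\<lambda>p. cmod (F p)"]) (auto intro: ennreal_leI)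
  qed
  have lim: "(\<lambda>i. ennreal (cmod (F (g i z))) * indicator (E i) z) \<longlonglongrightarrow> ennreal (cmod (F z)) * indicator U z" for z
  proof (cases "z \<in> U")
    case True
    \<comment> \<open>A nonempty complement matters because \<open>infdist\<close> to the empty set
      is 0 by convention.\<close>
    have "U \<noteq> UNIV"
      using U(2) not_bounded_UNIV by blast
    then have pos: "infdist z (- U) > 0"
      using True U(1) infdist_pos_not_in_closed[of "- U" z] by (auto simp: closed_def)
    have "(\<lambda>i. infdist (g i z) (- U) - cmod (g i z - z)) \<longlonglongrightarrow> infdist z (- U) - cmod (z - z)"
      by (intro tendsto_intros g(2))
    then have "\<forall>\<^sub>F i in sequentially. 0 < infdist (g i z) (- U) - cmod (g i z - z)"
      using pos by (intro order_tendstoD) auto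
    then have ev: "\<forall>\<^sub>F i in sequentially. z \<in> E i"
      by eventually_elim (use True in \<open>simp add: E_def\<close>)
    have "isCont F z"
      using F U(1) True by (simp add: continuous_on_eq_continuous_at)
    then have "(\<lambda>i. F (g i z)) \<longlonglongrightarrow> F z"
      using g(2)[of z] by (rule isCont_tendsto_compose)
    then have "(\<lambda>i. ennreal (cmod (F (g i z)))) \<longlonglongrightarrow> ennreal (cmod (F z)) * indicator U z"
      using True by (auto intro!: tendsto_intros)
    then show ?thesis
      by (rule Lim_transform_eventually) (use ev in \<open>auto elim!: eventually_mono\<close>)
  qed (simp add: E_def)
  have meas: "(\<lambda>z. ennreal (cmod (F (g i z))) * indicator (E i) z) \<in> borel_measurable lborel" for i
  proof -
    have "simple_function lborel (\<lambda>z. ennreal (cmod (F (g i z))))"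
      using simple_function_compose[OF g(1)[of i], of "\<lambda>p. ennreal (cmod (F p))"] by (simp add: o_def)
    from borel_measurable_simple_function[OF this] show ?thesis
      by measurable
  qed
  \<comment> \<open>Every point of \<open>U\<close> eventually lies in \<open>E i\<close>, so the
    integrands converge pointwise and Fatou's lemma carries the uniform bound to the limit.\<close>
  have "(\<integral>\<^sup>+ z\<in>U. ennreal (cmod (F z)) \<partial>lborel) =
      (\<integral>\<^sup>+ z. liminf (\<lambda>i. ennreal (cmod (F (g i z))) * indicator (E i) z) \<partial>lborel)"
    using lim_imp_Liminf[OF _ lim] by (intro nn_integral_cong) simp
  also have "\<dots> \<le> liminf (\<lambda>i. \<integral>\<^sup>+ z\<in>E i. ennreal (cmod (F (g i z))) \<partial>lborel)"
    by (intro nn_integral_liminf meas)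
  also have "\<dots> \<le> ennreal K"
    using bound by (intro Liminf_le) (auto intro: always_eventually)
  finally show ?thesis .
qed

section \<open>Integrability of resolvents of normal operators\<close>

lemma normal_resolvent_nn_integral:
  fixes T :: "'a::chilbert_space \<Rightarrow> 'a" and \<Lambda> :: "'a \<Rightarrow> complex"
  assumes T: "bounded_clinear T" and normal: "normal_operator T" and \<Lambda>: "bounded_clinear \<Lambda>"
    and U: "open U" "bounded U" "U \<inter> cspectrum T = {}"
  shows "(\<integral>\<^sup>+ z\<in>U. ennreal (cmod (\<Lambda> (resolvent T z x))) \<partial>lborel) < \<infinity>"
proof -
  obtain L where L: "L > 0" "\<And>v. cmod (\<Lambda> v) \<le> L * norm v"
    using bounded_clinear_bound[OF \<Lambda>] by metis
  obtain C where C: "C > 0"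
    "\<And>w. (\<integral>\<^sup>+ z\<in>U. ennreal (1 / cmod (z - w)) \<partial>lborel) \<le> ennreal C"
    using inverse_distance_integral_bound[of U] U emeasure_bounded_finite[of U] by auto
  have "(\<integral>\<^sup>+ z\<in>U. ennreal (cmod (\<Lambda> (resolvent T z x))) \<partial>lborel) \<le> ennreal (L * (2 * C * norm x))"
  proof (rule nn_integral_bound_by_finite_sums[where V = "cspectrum T" and C = C])
    have "continuous_on U (\<lambda>z. resolvent T z x)"
      using U(3) by (intro continuous_on_subset[OF continuous_on_resolvent]) auto
    then show "continuous_on U (\<lambda>z. \<Lambda> (resolvent T z x))"
      by (rule bounded_linear.continuous_on[OF bounded_clinear_bounded_linear[OF \<Lambda>]])
    fix P :: "complex set" and m :: "complex \<Rightarrow> real"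
    assume P: "finite P" "P \<subseteq> U" and m: "\<And>p. p \<in> P \<Longrightarrow> 0 \<le> m p"
      and le: "\<And>w. w \<in> cspectrum T \<Longrightarrow> (\<Sum>p\<in>P. m p / cmod (p - w)) \<le> 2 * C"
    \<comment> \<open>The conjugate phases make each term of \<Lambda> applied to the combination
      equal to \<open>m p\<close> times a modulus, while \<open>cmod (c p) \<le> m p\<close> keeps
      the symbol below \<open>2 * C\<close> on the spectrum.\<close>
    define c where "c = (\<lambda>p. complex_of_real (m p) * cnj (sgn (\<Lambda> (resolvent T p x))))"
    have cnj_sgn: "cnj (sgn u) * u = complex_of_real (cmod u)" for u
      using complex_norm_square[of u] by (cases "u = 0") (auto simp: sgn_eq power2_eq_square field_simps)
    have c: "cmod (c p) \<le> m p" if "p \<in> P" for p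
      using m[OF that] by (auto simp: c_def norm_mult norm_sgn)
    have "cmod (\<Sum>p\<in>P. c p / (p - w)) \<le> 2 * C" if "w \<in> cspectrum T" for w
    proof -
      have "cmod (\<Sum>p\<in>P. c p / (p - w)) \<le> (\<Sum>p\<in>P. m p / cmod (p - w))"
        using c by (intro sum_norm_le) (auto simp: norm_divide intro!: divide_right_mono)
      also have "\<dots> \<le> 2 * C"
        by (rule le[OF that])
      finally show ?thesis .
    qed
    then have "norm (\<Sum>p\<in>P. c p *\<^sub>C resolvent T p x) \<le> 2 * C * norm x"
      using P U(3) C(1) by (intro normal_resolvent_combination_bound T normal) auto
    then have le': "cmod (\<Lambda> (\<Sum>p\<in>P. c p *\<^sub>C resolvent T p x)) \<le> L * (2 * C * norm x)"
      using L(2)[of "\<Sum>p\<in>P. c p *\<^sub>C resolvent T p x"] L(1) by (meson mult_left_mono less_imp_le order_trans)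
    have eq: "\<Lambda> (\<Sum>p\<in>P. c p *\<^sub>C resolvent T p x) = complex_of_real (\<Sum>p\<in>P. m p * cmod (\<Lambda> (resolvent T p x)))"
      by (simp add: bounded_clinear_simps[OF \<Lambda>] scaleC_complex_def c_def mult.assoc cnj_sgn)
    show "(\<Sum>p\<in>P. m p * cmod (\<Lambda> (resolvent T p x))) \<le> L * (2 * C * norm x)"
      using le'[unfolded eq norm_of_real] by linarith
  qed (use U C in auto)
  then show ?thesis
    by (rule order.strict_trans1) simp
qed

theorem propositionV5p2:
  fixes T :: "'a::chilbert_space \<Rightarrow> 'a"
  assumes "bounded_clinear T"
    and "normal_operator T"
  shows "pointwise_regular T"
  unfolding pointwise_regular_def dunford_integrable_def
proof (intro conjI allI impI)
  fix x \<Omega> and \<Lambda> :: "'a \<Rightarrow> complex"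
  assume \<Omega>: "\<Omega> \<in> sets lebesgue \<and> compact (closure \<Omega>) \<and> cspectrum T \<subseteq> interior \<Omega>"
    and \<Lambda>: "bounded_clinear \<Lambda>"
  have closed: "closed (cspectrum T)"
    by (rule closed_cspectrum[OF assms(1)])
  obtain r where r: "closure \<Omega> \<subseteq> ball 0 r"
    using \<Omega> bounded_subset_ballD[OF compact_imp_bounded] by blast
  \<comment> \<open>The integral bound is for bounded open sets, whereas \<Omega> is only Lebesgue
    measurable; this \<open>U\<close> is open and contains \<Omega> minus the spectrum.\<close>
  define U where "U = ball 0 r - cspectrum T"
  have U: "open U" "bounded U" "U \<inter> cspectrum T = {}"
    using closed by (auto simp: U_def open_Diff bounded_subset[OF bounded_ball])
  define S where "S = \<Omega> - cspectrum T"
  have S: "S \<in> sets lebesgue"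
    using \<Omega> borel_closed[OF closed] sets_completionI_sets[of "cspectrum T" lborel] by (auto simp: S_def)
  have "S \<subseteq> U"
    using r closure_subset[of \<Omega>] by (auto simp: S_def U_def)
  define F where "F = (\<lambda>z. \<Lambda> (resolvent T z x))"
  have "continuous_on S (\<lambda>z. resolvent T z x)"
    by (rule continuous_on_subset[OF continuous_on_resolvent]) (auto simp: S_def)
  then have "continuous_on S F"
    unfolding F_def by (rule bounded_linear.continuous_on[OF bounded_clinear_bounded_linear[OF \<Lambda>]])
  then have meas: "F \<in> borel_measurable (lebesgue_on S)"
    using S by (rule continuous_imp_measurable_on_sets_lebesgue)
  have "(\<integral>\<^sup>+ z. norm (F z) \<partial>lebesgue_on S) = (\<integral>\<^sup>+ z\<in>S. norm (F z) \<partial>lebesgue)"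
    using S by (simp add: nn_integral_restrict_space)
  also have "\<dots> \<le> (\<integral>\<^sup>+ z\<in>U. norm (F z) \<partial>lebesgue)"
    using \<open>S \<subseteq> U\<close> by (intro nn_integral_mono) (auto split: split_indicator)
  \<comment> \<open>Completing the Borel measure does not change nonnegative integrals.\<close>
  also have "\<dots> = (\<integral>\<^sup>+ z\<in>U. norm (F z) \<partial>lborel)"
    by (rule nn_integral_completion)
  also have "\<dots> < \<infinity>"
    unfolding F_def by (rule normal_resolvent_nn_integral[OF assms \<Lambda> U])
  finally have "integrable (lebesgue_on S) F"
    using meas by (intro integrableI_bounded)
  then show "integrable (lebesgue_on (\<Omega> - cspectrum T)) (\<Lambda> \<circ> (\<lambda>z. resolvent T z x))"
    by (simp add: F_def S_def o_def)
qed (rule assms(1))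

end
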